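(* Let $\mathcal{C}\subset\mathbb{R}^n$ be nonempty, compact and convex, and let $f=g-h:\mathbb{R}^n\to\mathbb{R}$, where $g:\mathbb{R}^n\to\mathbb{R}$ is convex and continuously differentiable with $\|\nabla g(x)-\nabla g(y)\|\le L\|x-y\|$ for all $x,y\in\mathcal{C}$ (for some $L>0$), and $h:\mathbb{R}^n\to\mathbb{R}$ is convex (possibly nondifferentiable). Consider the Frank--Wolfe algorithm described in the context and assume $\omega_k<0$ for all $k=0,1,\dots$. For $j\in\mathbb{N}$ let $\lambda_j=\min\{1,|\omega_k|/(2^jL_k\|p^k-x^k\|^2)\}$ be the trial stepsize at iteration $k$. Then, at each iteration $k$, for all $j\in\mathbb{N}$ such that $2^jL_k\ge L$, the inequality $$f(x^k+\lambda_j(p^k-x^k))\le f(x^k)-|\omega_k|\lambda_j+\frac{2^jL_k}{2}\|p^k-x^k\|^2\lambda_j^2 \qquad (\ast)$$ holds. Consequently, the number $j_k$ in Step 4 is well defined. Furthermore, $j_k$ is the smallest nonnegative integer satisfying the two conditions $$2^{j_k}L_k\ge 2L_0,\qquad f(x^k+\lambda_k(p^k-x^k))\le f(x^k)-|\omega_k|\lambda_k+\frac{2^{j_k}L_k}{2}\|p^k-x^k\|^2\lambda_k^2,$$ where $\lambda_k:=\lambda_{j_k}$ (that is, $j_k$ is the smallest nonnegative integer $j$ with $2^jL_k\ge 2L_0$ for which $(\ast)$ holds). In addition, the sequence $\{x^k\}_{k\in\mathbb{N}}$ generated by the algorithm is well defined, and $$f(x^{k+1})\le f(x^k)-\tfrac12|\omega_k|\lambda_k,\qquad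 k=0,1,\dots.$$
   Context: Notation: $\|\cdot\|$ is the Euclidean norm, $\partial h(x)$ is the convex subdifferential of $h$ at $x$, and $\mathbb{N}=\{0,1,2,\dots\}$. Frank--Wolfe algorithm for $\min_{x\in\mathcal{C}} f(x)$, $f=g-h$: Step 0. Select $x^0\in\mathcal{C}$ and $L_0>0$; set $k=0$. Step 1. Take any $u^k\in\partial h(x^k)$. Set $j:=\min\{\ell\in\mathbb{N}:2^\ell L_k\ge 2L_0\}$. Step 2. Compute some $p^k\in\arg\min_{p\in\mathcal{C}}(\nabla g(x^k)-u^k)^{\top}(p-x^k)$ and set $\omega_k:=(\nabla g(x^k)-u^k)^{\top}(p^k-x^k)$ (so $\omega_k\le 0$). Step 3. If $\omega_k=0$, stop. Otherwise set $\lambda_j:=\min\left\{1,\frac{|\omega_k|}{2^jL_k\|p^k-x^k\|^2}\right\}$. Step 4. If $f(x^k+\lambda_j(p^k-x^k))\le f(x^k)-|\omega_k|\lambda_j+\frac{2^jL_k}{2}\|p^k-x^k\|^2\lambda_j^2$, set $j_k=j$ and go to Step 5. Otherwise replace $j$ by $j+1$ and go to Step 3. Step 5. Set $\lambda_k:=\lambda_{j_k}$, $x^{k+1}:=x^k+\lambda_k(p^k-x^k)$, $L_{k+1}:=2^{j_k-1}L_k$; replace $k$ by $k+1$ and go to Step 1. *)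

theory Defs
  imports "HOL-Analysis.Analysis"
begin

definition subdifferential :: "('a::real_inner \<Rightarrow> real) \<Rightarrow> 'a \<Rightarrow> 'a set" where
  "subdifferential h x = {u. \<forall>y. h x + u \<bullet> (y - x) \<le> h y}"

definition fw_argmin :: "'a::real_inner set \<Rightarrow> 'a \<Rightarrow> 'a \<Rightarrow> 'a set" where
  "fw_argmin C v x = {p. is_arg_min (\<lambda>q. v \<bullet> (q - x)) (\<lambda>q. q \<in> C) p}"

text \<open>The number $\omega_k$, for $x = x^k$, $u = u^k$, $p = p^k$; the function \<open>G\<close> is
  the gradient of \<open>g\<close>.\<close>

definition fw_omega :: "('a::real_inner \<Rightarrow> 'a) \<Rightarrow> 'a \<Rightarrow> 'a \<Rightarrow> 'a \<Rightarrow> real" where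
  "fw_omega G u p x = (G x - u) \<bullet> (p - x)"

text \<open>From here on \<open>M\<close> stands for the current estimate $L_k$, and \<open>w\<close> for $\omega_k$.\<close>

definition trial_step :: "real \<Rightarrow> real \<Rightarrow> 'a::real_inner \<Rightarrow> 'a \<Rightarrow> nat \<Rightarrow> real" where
  "trial_step w M x p j = min 1 (\<bar>w\<bar> / (2 ^ j * M * (norm (p - x))\<^sup>2))"

definition sufficient_decrease ::
    "('a::real_inner \<Rightarrow> real) \<Rightarrow> real \<Rightarrow> real \<Rightarrow> 'a \<Rightarrow> 'a \<Rightarrow> nat \<Rightarrow> bool" where
  "sufficient_decrease f w M x p j \<longleftrightarrow>
     (let t = trial_step w M x p j in
       f (x + t *\<^sub>R (p - x))
         \<le> f x - \<bar>w\<bar> * t + 2 ^ j * M / 2 * (norm (p - x))\<^sup>2 * t\<^sup>2)"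

definition initial_index :: "real \<Rightarrow> real \<Rightarrow> nat \<Rightarrow> bool" where
  "initial_index L0 M j \<longleftrightarrow> is_arg_min (\<lambda>l. l) (\<lambda>l. 2 ^ l * M \<ge> 2 * L0) j"

text \<open>\<open>backtrack f w M x p j i\<close>: the loop that replaces a rejected trial value by its successor,
  entered with \<open>j\<close>, terminates and accepts the value \<open>i\<close>. If no trial value is ever accepted, there is no
  such \<open>i\<close>.\<close>

inductive backtrack ::
    "('a::real_inner \<Rightarrow> real) \<Rightarrow> real \<Rightarrow> real \<Rightarrow> 'a \<Rightarrow> 'a \<Rightarrow> nat \<Rightarrow> nat \<Rightarrow> bool"
  for f w M x p where
  accept: "sufficient_decrease f w M x p j \<Longrightarrow> backtrack f w M x p j j"
| reject: "\<not> sufficient_decrease f w M x p j \<Longrightarrow> backtrack f w M x p (Suc j) i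
            \<Longrightarrow> backtrack f w M x p j i"

text \<open>\<open>i\<close> is a value $j_k$ delivered by the line search, including the choice of its initial value.\<close>

definition line_search ::
    "real \<Rightarrow> ('a::real_inner \<Rightarrow> real) \<Rightarrow> real \<Rightarrow> real \<Rightarrow> 'a \<Rightarrow> 'a \<Rightarrow> nat \<Rightarrow> bool" where
  "line_search L0 f w M x p i \<longleftrightarrow> (\<exists>j. initial_index L0 M j \<and> backtrack f w M x p j i)"

text \<open>\<open>fw_reaches C f G h u p x0 L0 k x M\<close>: the algorithm, started at \<open>x0\<close> and \<open>L0\<close>,
  reaches the beginning of iteration \<open>k\<close> with $x^k = x$ and $L_k = M$. The sequences \<open>u\<close> and
  \<open>p\<close> record the (arbitrary) selections of a subgradient of \<open>h\<close> and of a solution of the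
  linear subproblem. Iteration \<open>k\<close> is completed only if
  these selections are admissible at the current iterate, the stopping test fails, and the
  line search terminates; so a priori there may be no state for some \<open>k\<close>. The factor
  $2^{j_k-1}$ equals $1/2$ if $j_k = 0$, hence the integer exponent.\<close>

inductive fw_reaches ::
    "'a::real_inner set \<Rightarrow> ('a \<Rightarrow> real) \<Rightarrow> ('a \<Rightarrow> 'a) \<Rightarrow> ('a \<Rightarrow> real) \<Rightarrow>
     (nat \<Rightarrow> 'a) \<Rightarrow> (nat \<Rightarrow> 'a) \<Rightarrow> 'a \<Rightarrow> real \<Rightarrow> nat \<Rightarrow> 'a \<Rightarrow> real \<Rightarrow> bool"
  for C f G h u p x0 L0 where
  start: "fw_reaches C f G h u p x0 L0 0 x0 L0"
| step: "\<lbrakk> fw_reaches C f G h u p x0 L0 k x M;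
           u k \<in> subdifferential h x;
           p k \<in> fw_argmin C (G x - u k) x;
           w = fw_omega G (u k) (p k) x; w \<noteq> 0;
           line_search L0 f w M x (p k) i \<rbrakk>
         \<Longrightarrow> fw_reaches C f G h u p x0 L0 (Suc k)
               (x + trial_step w M x (p k) i *\<^sub>R (p k - x)) (2 powi (int i - 1) * M)"

end

(* Along a segment of C the Lipschitz gradient gives the quadratic upper bound for g, and a
   subgradient bounds -h from above by a linear function. Hence the acceptance test holds as soon
   as 2^j * L_k >= L, so the line search stops. The final decrease follows since the
   trial step t satisfies 2^j * L_k * |p - x|^2 * t <= |w|. *)

theory Submission
  imports Defs
begin

section \<open>Existence of subgradients and of solutions of the linear subproblem\<close>

text \<open>A hyperplane separates the strict epigraph of \<open>h\<close> from the point
  \<open>(x, h x)\<close>. Its normal \<open>(v, s)\<close> has \<open>s < 0\<close>, and scaling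
  the last component to -1 turns \<open>v\<close> into a subgradient.\<close>

lemma subdifferential_nonempty:
  fixes h :: "'a::euclidean_space \<Rightarrow> real"
  assumes "convex_on UNIV h"
  shows "subdifferential h x \<noteq> {}"
proof -
  define S where "S = {z. h (fst z) < snd z}"
  have "convex S"
  proof (rule convexI)
    fix y z :: "'a \<times> real" and a b :: real
    assume yz: "y \<in> S" "z \<in> S" and ab: "0 \<le> a" "0 \<le> b" "a + b = 1"
    have "h (a *\<^sub>R fst y + b *\<^sub>R fst z) \<le> a * h (fst y) + b * h (fst z)"
      using assms ab by (auto simp: convex_on_def)
    also have "\<dots> < a * snd y + b * snd z"
    \<comment> \<open>Strictness must come from a positive weight: if \<open>a = 0\<close>, then
      \<open>b = 1\<close> supplies it, otherwise \<open>a\<close> does.\<close>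
    proof (cases "a = 0")
      case True
      then show ?thesis using yz ab by (simp add: S_def)
    next
      case False
      then have "a * h (fst y) < a * snd y" using yz ab by (simp add: S_def)
      moreover have "b * h (fst z) \<le> b * snd z"
        using yz ab by (intro mult_left_mono) (auto simp: S_def)
      ultimately show ?thesis by linarith
    qed
    finally show "a *\<^sub>R y + b *\<^sub>R z \<in> S" by (simp add: S_def)
  qed
  moreover have "(x, h x + 1) \<in> S" and "S \<inter> {(x, h x)} = {}" by (auto simp: S_def)
  ultimately obtain a b where "a \<noteq> 0" and a: "\<forall>z\<in>S. a \<bullet> z \<le> b" "\<forall>z\<in>{(x, h x)}. b \<le> a \<bullet> z"
    using separating_hyperplane_sets[of S "{(x, h x)}"] by blast
  obtain v s where vs: "a = (v, s)" by (cases a)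
  have le: "v \<bullet> (y - x) + s * (t - h x) \<le> 0" if "h y < t" for y t
  proof -
    have "a \<bullet> (y, t) \<le> a \<bullet> (x, h x)"
      using a that by (force simp: S_def)
    then show ?thesis by (simp add: vs inner_diff_right algebra_simps)
  qed
  have "s \<le> 0" using le[of x "h x + 1"] by simp
  \<comment> \<open>A vertical hyperplane is impossible because \<open>h\<close> is finite
    everywhere: the point above \<open>x + v\<close> would force \<open>v = 0\<close>.\<close>
  moreover have "s \<noteq> 0"
  proof
    assume "s = 0"
    then have "v \<bullet> v \<le> 0" using le[of "x + v" "h (x + v) + 1"] by simp
    then show False using \<open>a \<noteq> 0\<close> \<open>s = 0\<close> by (simp add: vs zero_prod_def flip: not_less)
  qed
  ultimately have "s < 0" by simp
  define c where "c = inverse (- s)"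
  have "c > 0" using \<open>s < 0\<close> by (simp add: c_def)
  have "h x + (c *\<^sub>R v) \<bullet> (y - x) \<le> h y" for y
  \<comment> \<open>The separation only speaks of points strictly above the graph, so the bound is
    shown for every \<open>t > h y\<close>.\<close>
  proof (rule dense_ge)
    fix t assume "h y < t"
    then have "c * (v \<bullet> (y - x) + s * (t - h x)) \<le> 0"
      using le[of y t] \<open>c > 0\<close> by (simp add: mult_le_0_iff)
    moreover have "c * s = - 1" using \<open>s < 0\<close> by (simp add: c_def)
    then have "c * (s * (t - h x)) = - (t - h x)"
      by (metis mult.assoc mult_minus1)
    ultimately show "h x + (c *\<^sub>R v) \<bullet> (y - x) \<le> t"
      by (simp add: distrib_left)
  qed
  then have "c *\<^sub>R v \<in> subdifferential h x" by (simp add: subdifferential_def)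
  then show ?thesis by blast
qed

lemma fw_argmin_nonempty:
  assumes "compact C" "C \<noteq> {}"
  shows "fw_argmin C v x \<noteq> {}"
proof -
  have "continuous_on C (\<lambda>q. v \<bullet> (q - x))" by (intro continuous_intros)
  then obtain q where "q \<in> C" "\<forall>y\<in>C. v \<bullet> (q - x) \<le> v \<bullet> (y - x)"
    using continuous_attains_inf assms by blast
  then have "q \<in> fw_argmin C v x" by (simp add: fw_argmin_def is_arg_min_linorder)
  then show ?thesis by blast
qed

section \<open>Quadratic upper bound from a Lipschitz gradient\<close>

text \<open>Subtracting the linear and quadratic terms from \<open>g\<close> along the segment
  leaves a function with nonpositive derivative, by Cauchy-Schwarz and the Lipschitz bound. The
  segment stays in \<open>C\<close>, so a Lipschitz bound on \<open>C\<close> suffices.\<close>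

lemma lipschitz_gradient_upper_bound:
  fixes g :: "'a::real_inner \<Rightarrow> real"
  assumes "convex C" "x \<in> C" "y \<in> C"
    and grad: "\<And>z. z \<in> C \<Longrightarrow> GDERIV g z :> G z"
    and lip: "\<And>z z'. z \<in> C \<Longrightarrow> z' \<in> C \<Longrightarrow> norm (G z - G z') \<le> L * norm (z - z')"
  shows "g y \<le> g x + G x \<bullet> (y - x) + L / 2 * (norm (y - x))\<^sup>2"
proof -
  define d where "d = y - x"
  define \<phi> where "\<phi> t = g (x + t *\<^sub>R d) - t * (G x \<bullet> d) - L / 2 * t\<^sup>2 * (norm d)\<^sup>2" for t
  have "\<phi> 1 \<le> \<phi> 0"
  proof (rule DERIV_nonpos_imp_nonincreasing[of 0 1 \<phi>])
    fix t :: real assume t: "0 \<le> t" "t \<le> 1"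
    have "x + t *\<^sub>R d = (1 - t) *\<^sub>R x + t *\<^sub>R y" by (simp add: d_def algebra_simps)
    then have z: "x + t *\<^sub>R d \<in> C" using assms(1-3) t by (simp add: convex_alt)
    have "((\<lambda>t. x + t *\<^sub>R d) has_derivative (\<lambda>s. s *\<^sub>R d)) (at t)"
      by (auto intro!: derivative_eq_intros)
    moreover have "(g has_derivative (\<lambda>v. v \<bullet> G (x + t *\<^sub>R d))) (at (x + t *\<^sub>R d))"
      using grad[OF z] by (simp add: gderiv_def)
    ultimately have "((\<lambda>t. g (x + t *\<^sub>R d)) has_derivative (\<lambda>s. (s *\<^sub>R d) \<bullet> G (x + t *\<^sub>R d))) (at t)"
      by (rule has_derivative_compose)
    then have "((\<lambda>t. g (x + t *\<^sub>R d)) has_real_derivative G (x + t *\<^sub>R d) \<bullet> d) (at t)"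
      by (simp add: has_field_derivative_def inner_commute mult_commute_abs)
    then have "(\<phi> has_real_derivative
        G (x + t *\<^sub>R d) \<bullet> d - G x \<bullet> d - L * t * (norm d)\<^sup>2) (at t)"
      unfolding \<phi>_def by (auto intro!: derivative_eq_intros)
    moreover have "G (x + t *\<^sub>R d) \<bullet> d - G x \<bullet> d \<le> L * t * (norm d)\<^sup>2"
    proof -
      have "G (x + t *\<^sub>R d) \<bullet> d - G x \<bullet> d \<le> norm (G (x + t *\<^sub>R d) - G x) * norm d"
        by (metis inner_diff_left norm_cauchy_schwarz)
      also have "\<dots> \<le> (L * norm (t *\<^sub>R d)) * norm d"
        using lip[OF z \<open>x \<in> C\<close>] by (intro mult_right_mono) auto
      finally show ?thesis using t by (simp add: power2_eq_square mult.assoc)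
    qed
    ultimately show "\<exists>D. (\<phi> has_real_derivative D) (at t) \<and> D \<le> 0" by force
  qed simp
  then show ?thesis by (simp add: \<phi>_def d_def)
qed

section \<open>Trial steps and the acceptance test\<close>

lemma trial_step_bounds:
  assumes "w < 0" "M > 0" "p \<noteq> x"
  shows "0 < trial_step w M x p j" "trial_step w M x p j \<le> 1"
    "2 ^ j * M * (norm (p - x))\<^sup>2 * trial_step w M x p j \<le> \<bar>w\<bar>"
proof -
  define A where "A = 2 ^ j * M * (norm (p - x))\<^sup>2"
  have "A > 0" using assms by (simp add: A_def)
  have t: "trial_step w M x p j = min 1 (\<bar>w\<bar> / A)" by (simp add: trial_step_def A_def)
  show "0 < trial_step w M x p j" using \<open>A > 0\<close> \<open>w < 0\<close> by (simp add: t divide_neg_pos)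
  show "trial_step w M x p j \<le> 1" by (simp add: t)
  have "A * trial_step w M x p j \<le> A * (\<bar>w\<bar> / A)"
    unfolding t using \<open>A > 0\<close> by (intro mult_left_mono) auto
  also have "\<dots> = \<bar>w\<bar>" using \<open>A > 0\<close> by simp
  finally show "2 ^ j * M * (norm (p - x))\<^sup>2 * trial_step w M x p j \<le> \<bar>w\<bar>"
    unfolding A_def .
qed

lemma trial_point_in_convex:
  assumes "convex C" "x \<in> C" "p \<in> C" "w < 0" "M > 0" "p \<noteq> x"
  shows "x + trial_step w M x p j *\<^sub>R (p - x) \<in> C"
proof -
  let ?t = "trial_step w M x p j"
  have "x + ?t *\<^sub>R (p - x) = (1 - ?t) *\<^sub>R x + ?t *\<^sub>R p" by (simp add: algebra_simps)
  then show ?thesis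
    using trial_step_bounds[OF assms(4-6), of j] assms(1-3) by (simp add: convex_alt)
qed

text \<open>The bound for \<open>g\<close> and the subgradient inequality for \<open>h\<close> add
  up: their linear terms combine to \<open>t * w\<close>, which is
  \<open>- \<bar>w\<bar> * t\<close>, and \<open>L\<close> may be enlarged to
  \<open>2 ^ j * M\<close>.\<close>

lemma sufficient_decrease_large_estimate:
  fixes g h :: "'a::real_inner \<Rightarrow> real"
  assumes C: "convex C" "x \<in> C" "p \<in> C"
    and grad: "\<And>z. z \<in> C \<Longrightarrow> GDERIV g z :> G z"
    and lip: "\<And>z z'. z \<in> C \<Longrightarrow> z' \<in> C \<Longrightarrow> norm (G z - G z') \<le> L * norm (z - z')"
    and u: "u \<in> subdifferential h x"
    and w: "w = fw_omega G u p x" "w < 0" and "M > 0" and j: "L \<le> 2 ^ j * M"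
  shows "sufficient_decrease (\<lambda>z. g z - h z) w M x p j"
proof -
  define t where "t = trial_step w M x p j"
  let ?y = "x + t *\<^sub>R (p - x)"
  \<comment> \<open>Otherwise the inner product defining \<open>w\<close> would vanish.\<close>
  have "p \<noteq> x" using w by (auto simp: fw_omega_def)
  then have y: "?y \<in> C"
    unfolding t_def using C w \<open>M > 0\<close> by (intro trial_point_in_convex) auto
  have "g ?y \<le> g x + G x \<bullet> (?y - x) + L / 2 * (norm (?y - x))\<^sup>2"
    by (rule lipschitz_gradient_upper_bound[OF \<open>convex C\<close> \<open>x \<in> C\<close> y grad lip])
  moreover have "h x + u \<bullet> (?y - x) \<le> h ?y"
    using u unfolding subdifferential_def by blast
  moreover have "L / 2 * (norm (?y - x))\<^sup>2 \<le> 2 ^ j * M / 2 * (norm (?y - x))\<^sup>2"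
    using j by (intro mult_right_mono) auto
  ultimately have "g ?y - h ?y \<le> g x - h x + t * w + 2 ^ j * M / 2 * (norm (?y - x))\<^sup>2"
    by (simp add: w(1) fw_omega_def inner_diff_left right_diff_distrib)
  then show ?thesis
    using \<open>w < 0\<close> by (simp add: sufficient_decrease_def Let_def power_mult_distrib mult_ac flip: t_def)
qed

text \<open>The cap on the trial step makes the quadratic term at most half of
  \<open>\<bar>w\<bar> * t\<close>, so half of the linear decrease survives.\<close>

lemma sufficient_decrease_half:
  assumes "sufficient_decrease f w M x p j" "w < 0" "M > 0" "p \<noteq> x"
  shows "f (x + trial_step w M x p j *\<^sub>R (p - x)) \<le> f x - 1 / 2 * \<bar>w\<bar> * trial_step w M x p j"
proof -
  define t where "t = trial_step w M x p j"
  have "2 ^ j * M * (norm (p - x))\<^sup>2 * t * t \<le> \<bar>w\<bar> * t"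
    unfolding t_def using trial_step_bounds[OF assms(2-4), of j] by (intro mult_right_mono) auto
  moreover have "f (x + t *\<^sub>R (p - x)) \<le> f x - \<bar>w\<bar> * t + 2 ^ j * M / 2 * (norm (p - x))\<^sup>2 * t\<^sup>2"
    using assms(1) by (simp add: sufficient_decrease_def t_def Let_def)
  ultimately show ?thesis by (simp add: power2_eq_square flip: t_def)
qed

section \<open>The line search as a least-index problem\<close>

lemma backtrack_iff:
  "backtrack f w M x p j i \<longleftrightarrow>
    j \<le> i \<and> sufficient_decrease f w M x p i \<and> (\<forall>l. j \<le> l \<and> l < i \<longrightarrow> \<not> sufficient_decrease f w M x p l)"
  (is "_ \<longleftrightarrow> ?R j")
proof
  assume "backtrack f w M x p j i"
  then show "?R j"
  proof induction
    case (reject j i)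
    then show ?case by (metis Suc_leD Suc_leI le_neq_implies_less)
  qed auto
next
  assume R: "?R j"
  then have "j \<le> i" by simp
  then show "backtrack f w M x p j i" using R
  \<comment> \<open>The induction descends from \<open>i\<close>, where the test accepts, to the
    entry value, adding one rejection at a time.\<close>
  proof (induction j rule: inc_induct)
    case (step n)
    then have "\<not> sufficient_decrease f w M x p n" "backtrack f w M x p (Suc n) i" by auto
    then show ?case by (rule backtrack.reject)
  qed (simp add: backtrack.accept)
qed

lemma ex_power2_mult_ge:
  fixes M :: real
  assumes "M > 0"
  obtains j :: nat where "c \<le> 2 ^ j * M"
proof -
  obtain j :: nat where "c / M < 2 ^ j" using real_arch_pow[of 2 "c / M"] by auto
  then have "c \<le> 2 ^ j * M" using assms by (simp add: field_simps)
  then show ?thesis by (rule that)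
qed

lemma power2_mult_mono:
  fixes M :: real
  assumes "M > 0" "j \<le> l" "c \<le> 2 ^ j * M"
  shows "c \<le> 2 ^ l * M"
proof -
  have "2 ^ j * M \<le> 2 ^ l * M" using assms by (intro mult_right_mono power_increasing) auto
  then show ?thesis using assms by linarith
qed

text \<open>Once a witness \<open>k\<close> is known, this gives existence and uniqueness of the
  minimal index together.\<close>

lemma is_arg_min_Least:
  assumes "P (k::nat)"
  shows "is_arg_min (\<lambda>j. j) P i \<longleftrightarrow> i = (LEAST j. P j)"
  using assms unfolding is_arg_min_linorder
  by (metis LeastI Least_le antisym)

text \<open>Since \<open>2 ^ l * M\<close> grows with \<open>l\<close>, the condition on
  \<open>L0\<close> holds exactly from the initial index onwards. Hence the first index accepted
  from there is the least one meeting both conditions.\<close>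

lemma line_search_iff:
  assumes "M > 0"
  shows "line_search L0 f w M x p i \<longleftrightarrow>
    is_arg_min (\<lambda>j. j) (\<lambda>j. 2 * L0 \<le> 2 ^ j * M \<and> sufficient_decrease f w M x p j) i"
proof -
  obtain k where k: "2 * L0 \<le> 2 ^ k * M" by (rule ex_power2_mult_ge[OF assms])
  define j where "j = (LEAST l. 2 * L0 \<le> 2 ^ l * M)"
  have "initial_index L0 M l \<longleftrightarrow> l = j" for l
    using is_arg_min_Least[of "\<lambda>l. 2 * L0 \<le> 2 ^ l * M", OF k]
    by (simp add: initial_index_def j_def)
  moreover have "2 * L0 \<le> 2 ^ l * M \<longleftrightarrow> j \<le> l" for l
    unfolding j_def using power2_mult_mono[OF assms] LeastI[of _ k] k
    by (metis (mono_tags, lifting) Least_le)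
  ultimately show ?thesis
    unfolding line_search_def backtrack_iff is_arg_min_linorder
    by (auto simp flip: not_less)
qed

section \<open>Well-definedness and descent of the whole iteration\<close>

theorem proposition5p1:
  fixes C :: "(real ^ 'n) set"
    and f g h :: "real ^ 'n \<Rightarrow> real"
    and G :: "real ^ 'n \<Rightarrow> real ^ 'n"
    and L L0 :: real
    and x0 :: "real ^ 'n"
    and u p :: "nat \<Rightarrow> real ^ 'n"
  assumes C: "C \<noteq> {}" "compact C" "convex C"
    and f: "f = (\<lambda>x. g x - h x)"
    and g_convex: "convex_on UNIV g"
    and g_gradient: "\<And>x. GDERIV g x :> G x"
    and g_C1: "continuous_on UNIV G"
    and L_pos: "L > 0"
    and g_Lipschitz: "\<And>x y. x \<in> C \<Longrightarrow> y \<in> C \<Longrightarrow> norm (G x - G y) \<le> L * norm (x - y)"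
    and h_convex: "convex_on UNIV h"
    and start: "x0 \<in> C" "L0 > 0"
    \<comment> \<open>whenever iteration k is reached, u k and p k are the selections the algorithm makes there\<close>
    and u_choice: "\<And>k x M. fw_reaches C f G h u p x0 L0 k x M \<Longrightarrow> u k \<in> subdifferential h x"
    and p_choice: "\<And>k x M. fw_reaches C f G h u p x0 L0 k x M \<Longrightarrow>
                     p k \<in> fw_argmin C (G x - u k) x"
    and omega_neg: "\<And>k x M. fw_reaches C f G h u p x0 L0 k x M \<Longrightarrow>
                     fw_omega G (u k) (p k) x < 0"
  shows
    \<comment> \<open>a subgradient and a solution of the linear subproblem can always be selected\<close>
    "(\<forall>y\<in>C. subdifferential h y \<noteq> {}) \<and> (\<forall>y\<in>C. \<forall>v. fw_argmin C v y \<noteq> {}) \<and>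
     (\<exists>x Lk jk.
        \<comment> \<open>the sequence of iterates is well defined: each iteration is reached, in exactly one state\<close>
        (\<forall>k y M. fw_reaches C f G h u p x0 L0 k y M \<longleftrightarrow> y = x k \<and> M = Lk k) \<and>
        (\<forall>k. x k \<in> C) \<and>
        (\<forall>k. let w = fw_omega G (u k) (p k) (x k);
                 lam = trial_step w (Lk k) (x k) (p k)
             in
               (\<forall>j. 2 ^ j * Lk k \<ge> L \<longrightarrow>
                  f (x k + lam j *\<^sub>R (p k - x k))
                    \<le> f (x k) - \<bar>w\<bar> * lam j
                        + 2 ^ j * Lk k / 2 * (norm (p k - x k))\<^sup>2 * (lam j)\<^sup>2) \<and>
               \<comment> \<open>the line search terminates, with the unique outcome \<open>jk k\<close>\<close>
               (\<forall>i. line_search L0 f w (Lk k) (x k) (p k) i \<longleftrightarrow> i = jk k) \<and>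
               is_arg_min (\<lambda>j. j)
                 (\<lambda>j. 2 ^ j * Lk k \<ge> 2 * L0 \<and>
                      f (x k + lam j *\<^sub>R (p k - x k))
                        \<le> f (x k) - \<bar>w\<bar> * lam j
                            + 2 ^ j * Lk k / 2 * (norm (p k - x k))\<^sup>2 * (lam j)\<^sup>2)
                 (jk k) \<and>
               f (x (Suc k)) \<le> f (x k) - 1 / 2 * \<bar>w\<bar> * lam (jk k)))"
proof -
  note reaches = fw_reaches.intros[where C = C and f = f and G = G and h = h and u = u and p = p
      and ?x0.0 = x0 and ?L0.0 = L0]
  let ?R = "fw_reaches C f G h u p x0 L0"
  let ?w = "\<lambda>k x. fw_omega G (u k) (p k) x"
  have p_in: "p k \<in> C" and p_ne: "p k \<noteq> x" if "?R k x M" for k x M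
    using p_choice[OF that] omega_neg[OF that]
    by (auto simp: fw_argmin_def is_arg_min_def fw_omega_def)
  have decrease: "sufficient_decrease f (?w k x) M x (p k) j"
    if "?R k x M" "x \<in> C" "M > 0" "L \<le> 2 ^ j * M" for k x M j
    unfolding f
    by (rule sufficient_decrease_large_estimate[OF \<open>convex C\<close> \<open>x \<in> C\<close> p_in[OF that(1)] g_gradient
          g_Lipschitz u_choice[OF that(1)] refl omega_neg[OF that(1)] \<open>M > 0\<close> that(4)])
  have search: "\<exists>i. \<forall>i'. line_search L0 f (?w k x) M x (p k) i' \<longleftrightarrow> i' = i"
    if "?R k x M" "x \<in> C" "M > 0" for k x M
  proof -
    \<comment> \<open>One exponent large enough for both the acceptance test and the starting
      condition witnesses that the search stops.\<close>
    obtain j where j: "max L (2 * L0) \<le> 2 ^ j * M" by (rule ex_power2_mult_ge[OF \<open>M > 0\<close>])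
    then have "2 * L0 \<le> 2 ^ j * M \<and> sufficient_decrease f (?w k x) M x (p k) j"
      using decrease[OF that] by simp
    from is_arg_min_Least[of "\<lambda>j. 2 * L0 \<le> 2 ^ j * M \<and> sufficient_decrease f (?w k x) M x (p k) j",
        OF this]
    show ?thesis unfolding line_search_iff[OF \<open>M > 0\<close>] by blast
  qed
  \<comment> \<open>Feasibility and a positive estimate are carried along because termination of the
    next line search depends on them.\<close>
  have "\<exists>x M. (\<forall>y M'. ?R k y M' \<longleftrightarrow> y = x \<and> M' = M) \<and> x \<in> C \<and> M > 0" for k
  proof (induction k)
    case 0
    have "?R 0 y M' \<longleftrightarrow> y = x0 \<and> M' = L0" for y M'
      by (auto intro: reaches elim: fw_reaches.cases)
    then show ?case using start by blast
  next
    case (Suc k)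
    then obtain x M where R: "\<And>y M'. ?R k y M' \<longleftrightarrow> y = x \<and> M' = M" and "x \<in> C" "M > 0" by blast
    then have Rk: "?R k x M" by simp
    obtain i where i: "\<And>i'. line_search L0 f (?w k x) M x (p k) i' \<longleftrightarrow> i' = i"
      using search[OF Rk \<open>x \<in> C\<close> \<open>M > 0\<close>] by blast
    let ?y = "x + trial_step (?w k x) M x (p k) i *\<^sub>R (p k - x)"
    have "?R (Suc k) ?y (2 powi (int i - 1) * M)"
      using reaches(2)[OF Rk u_choice[OF Rk] p_choice[OF Rk] refl] omega_neg[OF Rk] i by auto
    moreover have "y = ?y \<and> M' = 2 powi (int i - 1) * M" if "?R (Suc k) y M'" for y M'
      using that by cases (auto simp: R i)
    moreover have "?y \<in> C"
      using trial_point_in_convex[OF \<open>convex C\<close> \<open>x \<in> C\<close> p_in[OF Rk] omega_neg[OF Rk] \<open>M > 0\<close> p_ne[OF Rk]] .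
    moreover have "2 powi (int i - 1) * M > 0" using \<open>M > 0\<close> by simp
    ultimately show ?case by blast
  qed
  then obtain x Lk where R: "\<And>k y M. ?R k y M \<longleftrightarrow> y = x k \<and> M = Lk k"
    and inv: "\<And>k. x k \<in> C" "\<And>k. Lk k > 0"
    by metis
  then have Rk: "?R k (x k) (Lk k)" for k by simp
  obtain jk where jk: "\<And>k i. line_search L0 f (?w k (x k)) (Lk k) (x k) (p k) i \<longleftrightarrow> i = jk k"
    using search[OF Rk inv] by metis
  have amin: "is_arg_min (\<lambda>j. j) (\<lambda>j. 2 * L0 \<le> 2 ^ j * Lk k \<and>
      sufficient_decrease f (?w k (x k)) (Lk k) (x k) (p k) j) (jk k)" for k
    using jk line_search_iff[OF inv(2)] by blast
  \<comment> \<open>The sequences were obtained from uniqueness of states alone; the update formula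
    follows since the state produced by the step rule must be the one at
    \<open>Suc k\<close>.\<close>
  have x_Suc: "x (Suc k) = x k + trial_step (?w k (x k)) (Lk k) (x k) (p k) (jk k) *\<^sub>R (p k - x k)" for k
    using reaches(2)[OF Rk u_choice[OF Rk] p_choice[OF Rk] refl, of k "jk k"] omega_neg[OF Rk, of k]
    by (auto simp: jk R)
  have half: "f (x (Suc k)) \<le> f (x k) - 1 / 2 * \<bar>?w k (x k)\<bar> *
      trial_step (?w k (x k)) (Lk k) (x k) (p k) (jk k)" for k
    unfolding x_Suc using amin[of k]
    by (intro sufficient_decrease_half omega_neg[OF Rk] inv p_ne[OF Rk]) (simp add: is_arg_min_def)
  show ?thesis
  proof (intro conjI ballI allI)
    fix y show "subdifferential h y \<noteq> {}" by (rule subdifferential_nonempty[OF h_convex])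
    fix v show "fw_argmin C v y \<noteq> {}" by (rule fw_argmin_nonempty[OF C(2,1)])
  next
    show "\<exists>x Lk jk. (\<forall>k y M. ?R k y M \<longleftrightarrow> y = x k \<and> M = Lk k) \<and> (\<forall>k. x k \<in> C) \<and>
        (\<forall>k. let w = ?w k (x k); lam = trial_step w (Lk k) (x k) (p k) in
          (\<forall>j. 2 ^ j * Lk k \<ge> L \<longrightarrow>
             f (x k + lam j *\<^sub>R (p k - x k))
               \<le> f (x k) - \<bar>w\<bar> * lam j + 2 ^ j * Lk k / 2 * (norm (p k - x k))\<^sup>2 * (lam j)\<^sup>2) \<and>
          (\<forall>i. line_search L0 f w (Lk k) (x k) (p k) i \<longleftrightarrow> i = jk k) \<and>
          is_arg_min (\<lambda>j. j)
            (\<lambda>j. 2 ^ j * Lk k \<ge> 2 * L0 \<and>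
                 f (x k + lam j *\<^sub>R (p k - x k))
                   \<le> f (x k) - \<bar>w\<bar> * lam j + 2 ^ j * Lk k / 2 * (norm (p k - x k))\<^sup>2 * (lam j)\<^sup>2)
            (jk k) \<and>
          f (x (Suc k)) \<le> f (x k) - 1 / 2 * \<bar>w\<bar> * lam (jk k))"
      using decrease[OF Rk inv] amin half R inv(1) jk
      unfolding sufficient_decrease_def Let_def by (intro exI[of _ x] exI[of _ Lk] exI[of _ jk]) blast
  qed
qed

end
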